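(* Let $A$ be an $n\times n$ row stochastic and irreducible matrix. For any network node $j\in\{1,\dots,n\}$, the pair $(A,C_j)$ is detectable.
   Context: Row stochastic means nonnegative entries with rows summing to one. The graph associated with $A$ is the directed graph on $V=\{1,\dots,n\}$ with edge $(j,i)$ if and only if $A_{ij}\neq0$; the neighbor set of $j$ is $N_j=\{i\in V:(i,j)\in E\}$. For $N_j=\{n_1,\dots,n_p\}$, $C_j=[e_{n_1}\cdots e_{n_p}]^{\mathsf T}$ with $e_i$ the canonical basis vectors. Detectability is in the discrete-time sense: there are no $\lambda\in\mathbb{C}$ with $|\lambda|\ge1$ and $v\neq0$ such that $Av=\lambda v$ and $C_jv=0$. *)

theory Defs
  imports Complex_Main "Jordan_Normal_Form.Char_Poly" "HOL-Combinatorics.Permutations"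
begin

text \<open>
  Indices are 0-based, as usual for the matrix type: the node set is \<open>{..<n}\<close>, where
  \<open>n = dim_row A\<close>.
\<close>

definition row_stochastic :: "real mat \<Rightarrow> bool" where
  "row_stochastic A \<longleftrightarrow>
     (\<forall>i<dim_row A. (\<forall>j<dim_col A. 0 \<le> A $$ (i, j)) \<and> (\<Sum>j<dim_col A. A $$ (i, j)) = 1)"

definition perm_matrix :: "nat \<Rightarrow> (nat \<Rightarrow> nat) \<Rightarrow> real mat" where
  "perm_matrix n \<sigma> = mat_of_cols n (map (\<lambda>j. unit_vec n (\<sigma> j)) [0..<n])"

text \<open>
  A square matrix is reducible if some simultaneous permutation of its rows and columns makes it
  block upper triangular with nonempty square diagonal blocks. With this convention every
  1-by-1 matrix is irreducible; the texts that call the zero 1-by-1 matrix reducible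
  differ only there.
\<close>

definition reducible_mat :: "real mat \<Rightarrow> bool" where
  "reducible_mat A \<longleftrightarrow>
     (let n = dim_row A in
      \<exists>\<sigma> r B C D. \<sigma> permutes {..<n} \<and> 1 \<le> r \<and> r < n \<and>
        B \<in> carrier_mat r r \<and> C \<in> carrier_mat r (n - r) \<and> D \<in> carrier_mat (n - r) (n - r) \<and>
        transpose_mat (perm_matrix n \<sigma>) * A * perm_matrix n \<sigma>
          = four_block_mat B C (0\<^sub>m (n - r) r) D)"

definition irreducible_mat :: "real mat \<Rightarrow> bool" where
  "irreducible_mat A \<longleftrightarrow> square_mat A \<and> \<not> reducible_mat A"

text \<open>
  The edge \<open>(j, i)\<close> belongs to the entry \<open>A $$ (i, j)\<close>, so the neighbors of \<open>j\<close> are the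
  positions of the nonzero entries of row \<open>j\<close>, including \<open>j\<close> itself if \<open>A $$ (j, j) \<noteq> 0\<close>.
\<close>

definition graph_edges :: "real mat \<Rightarrow> (nat \<times> nat) set" where
  "graph_edges A = {(j, i). j < dim_row A \<and> i < dim_row A \<and> A $$ (i, j) \<noteq> 0}"

definition neighbors :: "real mat \<Rightarrow> nat \<Rightarrow> nat set" where
  "neighbors A j = {i. i < dim_row A \<and> (i, j) \<in> graph_edges A}"

definition neighbor_output :: "real mat \<Rightarrow> nat \<Rightarrow> real mat" where
  "neighbor_output A j = transpose_mat
     (mat_of_cols (dim_row A) (map (unit_vec (dim_row A)) (sorted_list_of_set (neighbors A j))))"

definition detectable :: "real mat \<Rightarrow> real mat \<Rightarrow> bool" where
  "detectable A C \<longleftrightarrow>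
     \<not> (\<exists>(z::complex) v. 1 \<le> cmod z \<and> eigenvector (map_mat complex_of_real A) v z \<and>
          map_mat complex_of_real C *\<^sub>v v = 0\<^sub>v (dim_row C))"

end

theory Submission
  imports Defs
begin

text \<open>
  Let \<open>v\<close> be an eigenvector for \<open>z\<close> with \<open>1 \<le> cmod z\<close>. Row \<open>i\<close> of \<open>A v = z v\<close> bounds
  \<open>cmod z * cmod (v\<^sub>i)\<close> by a weighted average of the moduli \<open>cmod (v\<^sub>k)\<close>, so where the modulus is
  maximal every entry in the support of row \<open>i\<close> has maximal modulus too. By irreducibility all
  entries then have the same modulus, so none of them is zero. If the output at \<open>j\<close> vanished,
  however, row \<open>j\<close> would read \<open>z v\<^sub>j = 0\<close>.
\<close>

lemma perm_matrix_carrier [simp]: "perm_matrix n \<sigma> \<in> carrier_mat n n"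
  by (rule carrier_matI) (simp_all add: perm_matrix_def)

lemma col_perm_matrix: "k < n \<Longrightarrow> col (perm_matrix n \<sigma>) k = unit_vec n (\<sigma> k)"
  by (simp add: perm_matrix_def)

text \<open>Column \<open>k\<close> of the permutation matrix is the unit vector at
  \<open>\<sigma> k\<close>, so the right factor selects a column of \<open>A\<close> and the
  transposed left factor a row. This turns the block condition in \<open>reducible_mat\<close> into
  a condition on single entries.\<close>

lemma perm_matrix_conjugate_index:
  assumes A: "A \<in> carrier_mat n n" and \<sigma>: "\<sigma> permutes {..<n}" and "i < n" "k < n"
  shows "(transpose_mat (perm_matrix n \<sigma>) * A * perm_matrix n \<sigma>) $$ (i, k) = A $$ (\<sigma> i, \<sigma> k)"
proof -
  let ?P = "perm_matrix n \<sigma>"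
  have P: "?P \<in> carrier_mat n n" by simp
  have lt: "\<sigma> i < n" "\<sigma> k < n"
    using permutes_in_image[OF \<sigma>] assms by auto
  have "(transpose_mat ?P * A * ?P) $$ (i, k) = row (transpose_mat ?P * A) i \<bullet> unit_vec n (\<sigma> k)"
    using A carrier_matD[OF P] assms by (simp add: col_perm_matrix)
  also have "\<dots> = (transpose_mat ?P * A) $$ (i, \<sigma> k)"
    using A carrier_matD[OF P] assms lt by (subst scalar_prod_right_unit) auto
  also have "\<dots> = unit_vec n (\<sigma> i) \<bullet> col A (\<sigma> k)"
    using A carrier_matD[OF P] assms lt by (simp add: col_perm_matrix)
  also have "\<dots> = A $$ (\<sigma> i, \<sigma> k)"
    using A assms lt by (subst scalar_prod_left_unit) auto
  finally show ?thesis .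
qed

text \<open>Glues a bijection onto the complement of \<open>S\<close> with one onto
  \<open>S\<close>. The set \<open>S\<close> goes last because \<open>reducible_mat\<close> has its
  zero block at the lower left.\<close>

lemma permutation_onto_final_segment:
  fixes S :: "nat set"
  assumes S: "S \<subseteq> {..<n}"
  obtains \<sigma> where "\<sigma> permutes {..<n}"
    "\<And>i. i < n - card S \<Longrightarrow> \<sigma> i \<notin> S" "\<And>i. n - card S \<le> i \<Longrightarrow> i < n \<Longrightarrow> \<sigma> i \<in> S"
proof -
  define r where "r = n - card S"
  have fin: "finite S" using S finite_subset by blast
  have le: "card S \<le> n" using card_mono[OF _ S] by simp
  have "card {..<r} = card ({..<n} - S)"
    using S fin by (simp add: r_def card_Diff_subset)
  then obtain f where f: "bij_betw f {..<r} ({..<n} - S)"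
    using finite_same_card_bij[of "{..<r}" "{..<n} - S"] by auto
  have "card {r..<n} = card S" using le by (simp add: r_def)
  then obtain g where g: "bij_betw g {r..<n} S"
    using finite_same_card_bij[of "{r..<n}" S] fin by auto
  \<comment> \<open>Being the identity from \<open>n\<close> on is part of
    \<open>permutes\<close>.\<close>
  define \<sigma> where "\<sigma> i = (if i < r then f i else if i < n then g i else i)" for i
  have "bij_betw \<sigma> {..<r} ({..<n} - S)"
    using f by (rule iffD1[OF bij_betw_cong, rotated]) (simp add: \<sigma>_def)
  moreover have "bij_betw \<sigma> {r..<n} S"
    using g by (rule iffD1[OF bij_betw_cong, rotated]) (simp add: \<sigma>_def)
  ultimately have "bij_betw \<sigma> ({..<r} \<union> {r..<n}) (({..<n} - S) \<union> S)"
    by (rule bij_betw_combine) auto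
  moreover have "{..<r} \<union> {r..<n} = {..<n}" by (auto simp: r_def)
  moreover have "({..<n} - S) \<union> S = {..<n}" using S by auto
  ultimately have "bij_betw \<sigma> {..<n} {..<n}" by simp
  then have "\<sigma> permutes {..<n}"
    by (rule bij_imp_permutes) (auto simp: \<sigma>_def r_def)
  moreover have "\<sigma> i \<notin> S" if "i < r" for i
    using bij_betwE[OF f] that by (auto simp: \<sigma>_def)
  moreover have "\<sigma> i \<in> S" if "r \<le> i" "i < n" for i
    using bij_betwE[OF g] that by (auto simp: \<sigma>_def)
  ultimately show thesis using that unfolding r_def by blast
qed

text \<open>This is irreducibility in terms of the graph. If \<open>S\<close> were proper, listing
  its complement first and \<open>S\<close> last would leave only zeros in the rows of
  \<open>S\<close> and the columns of the complement, which is a block triangular form.\<close>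

lemma irreducible_mat_closed_set:
  assumes A: "A \<in> carrier_mat n n" and irr: "irreducible_mat A"
    and S: "S \<subseteq> {..<n}" "S \<noteq> {}"
    and closed: "\<And>i k. i \<in> S \<Longrightarrow> k < n \<Longrightarrow> A $$ (i, k) \<noteq> 0 \<Longrightarrow> k \<in> S"
  shows "S = {..<n}"
proof (rule ccontr)
  assume "S \<noteq> {..<n}"
  then have "card S < n" using psubset_card_mono[of "{..<n}" S] S by auto
  moreover have "card S > 0" using S finite_subset[OF S(1)] by (simp add: card_gt_0_iff)
  \<comment> \<open>Both diagonal blocks are nonempty, as \<open>S\<close> is neither everything nor
    empty.\<close>
  ultimately have r: "1 \<le> n - card S" "n - card S < n" by auto
  obtain \<sigma> where \<sigma>: "\<sigma> permutes {..<n}"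
    and lo: "\<And>i. i < n - card S \<Longrightarrow> \<sigma> i \<notin> S"
    and hi: "\<And>i. n - card S \<le> i \<Longrightarrow> i < n \<Longrightarrow> \<sigma> i \<in> S"
    using permutation_onto_final_segment[OF S(1)] by blast
  define r where "r = n - card S"
  let ?M = "transpose_mat (perm_matrix n \<sigma>) * A * perm_matrix n \<sigma>"
  have M: "?M \<in> carrier_mat n n"
    using A by (intro mult_carrier_mat[of _ n n]) auto
  define B where "B = mat r r (\<lambda>(i, k). ?M $$ (i, k))"
  define C where "C = mat r (n - r) (\<lambda>(i, k). ?M $$ (i, k + r))"
  define D where "D = mat (n - r) (n - r) (\<lambda>(i, k). ?M $$ (i + r, k + r))"
  \<comment> \<open>Here \<open>\<sigma> i\<close> lies in \<open>S\<close> and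
    \<open>\<sigma> k\<close> does not, so a nonzero entry would contradict closedness.\<close>
  have zero: "?M $$ (i, k) = 0" if "r \<le> i" "i < n" "k < r" for i k
  proof -
    have "k < n" using that by simp
    moreover from this have "\<sigma> k < n" using permutes_in_image[OF \<sigma>] by auto
    ultimately show ?thesis
      using closed[OF hi, of i "\<sigma> k"] lo[of k] that perm_matrix_conjugate_index[OF A \<sigma>]
      unfolding r_def by auto
  qed
  have "?M = four_block_mat B C (0\<^sub>m (n - r) r) D"
    using M r zero by (intro eq_matI) (auto simp: B_def C_def D_def r_def)
  then have "reducible_mat A"
    unfolding reducible_mat_def Let_def using A \<sigma> r
    by (intro exI[of _ \<sigma>] exI[of _ r] exI[of _ B] exI[of _ C] exI[of _ D])
      (auto simp: B_def C_def D_def r_def)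
  with irr show False by (simp add: irreducible_mat_def)
qed

text \<open>The neighbor \<open>i\<close> sits at some position \<open>k\<close> of the sorted list,
  and row \<open>k\<close> of the output matrix is the unit vector at \<open>i\<close>; hence
  component \<open>k\<close> of the output is \<open>v $ i\<close>.\<close>

lemma neighbor_output_kernel:
  fixes v :: "'a :: real_algebra_1 vec"
  assumes v: "v \<in> carrier_vec (dim_row A)"
    and zero: "map_mat of_real (neighbor_output A j) *\<^sub>v v = 0\<^sub>v (dim_row (neighbor_output A j))"
    and i: "i \<in> neighbors A j"
  shows "v $ i = 0"
proof -
  define L where "L = sorted_list_of_set (neighbors A j)"
  have "finite (neighbors A j)" by (simp add: neighbors_def)
  then have L: "set L = neighbors A j" by (simp add: L_def)
  with i obtain k where k: "k < length L" "L ! k = i" by (metis in_set_conv_nth)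
  have lt: "i < dim_row A" using i by (simp add: neighbors_def)
  have dim: "dim_row (neighbor_output A j) = length L" "dim_col (neighbor_output A j) = dim_row A"
    by (auto simp: neighbor_output_def L_def)
  have row: "row (map_mat of_real (neighbor_output A j)) k = (unit_vec (dim_row A) i :: 'a vec)"
    using k lt by (intro eq_vecI) (auto simp: neighbor_output_def L_def mat_of_cols_index unit_vec_def)
  have "v $ i = unit_vec (dim_row A) i \<bullet> v"
    using v lt by simp
  also have "\<dots> = (map_mat of_real (neighbor_output A j) *\<^sub>v v) $ k"
    using k dim row by simp
  also have "\<dots> = 0" using zero k dim by simp
  finally show ?thesis .
qed

lemma row_stochastic_max_modulus_step:
  fixes v :: "complex vec"
  assumes A: "A \<in> carrier_mat n n" and st: "row_stochastic A"
    and z: "1 \<le> cmod z"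
    and eig: "z * v $ i = (\<Sum>k<n. of_real (A $$ (i, k)) * v $ k)"
    and max: "\<And>k. k < n \<Longrightarrow> cmod (v $ k) \<le> cmod (v $ i)"
    and i: "i < n" and k: "k < n" and nz: "A $$ (i, k) \<noteq> 0"
  shows "cmod (v $ k) = cmod (v $ i)"
proof (rule ccontr)
  assume "cmod (v $ k) \<noteq> cmod (v $ i)"
  with max[OF k] have less: "cmod (v $ k) < cmod (v $ i)" by simp
  have nonneg: "0 \<le> A $$ (i, l)" if "l < n" for l
    using st A i that by (auto simp: row_stochastic_def)
  have sum1: "(\<Sum>l<n. A $$ (i, l)) = 1"
    using st A i by (auto simp: row_stochastic_def)
  have "cmod (v $ i) \<le> cmod (z * v $ i)"
    using mult_right_mono[OF z, of "cmod (v $ i)"] by (simp add: norm_mult)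
  also have "\<dots> \<le> (\<Sum>l<n. A $$ (i, l) * cmod (v $ l))"
    unfolding eig using nonneg by (intro sum_norm_le) (simp add: norm_mult)
  \<comment> \<open>Strictness comes from the summand at \<open>k\<close>, whose weight is
    nonnegative and nonzero, hence positive.\<close>
  also have "\<dots> < (\<Sum>l<n. A $$ (i, l) * cmod (v $ i))"
  proof (rule sum_strict_mono_ex1)
    show "\<forall>l\<in>{..<n}. A $$ (i, l) * cmod (v $ l) \<le> A $$ (i, l) * cmod (v $ i)"
      using max nonneg by (auto intro: mult_left_mono)
    show "\<exists>l\<in>{..<n}. A $$ (i, l) * cmod (v $ l) < A $$ (i, l) * cmod (v $ i)"
      using k nz nonneg[OF k] less by (intro bexI[of _ k]) auto
  qed simp
  also have "\<dots> = cmod (v $ i)"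
    using sum1 by (simp flip: sum_distrib_right)
  finally show False by simp
qed

theorem lemmaV1:
  fixes A :: "real mat" and n j :: nat
  assumes "A \<in> carrier_mat n n"
    and "row_stochastic A"
    and "irreducible_mat A"
    and "j < n"
  shows "detectable A (neighbor_output A j)"
  unfolding detectable_def
proof (rule notI, elim exE conjE)
  fix z :: complex and v
  assume z: "1 \<le> cmod z"
    and eigv: "eigenvector (map_mat complex_of_real A) v z"
    and ker: "map_mat complex_of_real (neighbor_output A j) *\<^sub>v v
      = 0\<^sub>v (dim_row (neighbor_output A j))"
  note A = assms(1)
  have v: "v \<in> carrier_vec n" "v \<noteq> 0\<^sub>v n"
    and Av: "map_mat complex_of_real A *\<^sub>v v = z \<cdot>\<^sub>v v"
    using eigv A by (auto simp: eigenvector_def)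
  have eig: "z * v $ i = (\<Sum>k<n. of_real (A $$ (i, k)) * v $ k)" if "i < n" for i
    using arg_cong[OF Av, of "\<lambda>w. w $ i"] A v that
    by (simp add: scalar_prod_def lessThan_atLeast0)
  \<comment> \<open>Either the weight is zero, or \<open>k\<close> is a neighbor of \<open>j\<close>
    and the output forces \<open>v $ k = 0\<close>.\<close>
  have "of_real (A $$ (j, k)) * v $ k = 0" if "k < n" for k
    using neighbor_output_kernel[OF _ ker, of k] A v assms(4) that
    by (cases "A $$ (j, k) = 0") (auto simp: neighbors_def graph_edges_def)
  with eig[OF assms(4)] z have vj: "v $ j = 0" by auto
  define M where "M = Max ((\<lambda>i. cmod (v $ i)) ` {..<n})"
  define S where "S = {i. i < n \<and> cmod (v $ i) = M}"
  have le: "cmod (v $ i) \<le> M" if "i < n" for i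
    unfolding M_def using that by (intro Max_ge) auto
  have "M \<in> (\<lambda>i. cmod (v $ i)) ` {..<n}"
    unfolding M_def using assms(4) by (intro Max_in) auto
  then have "S \<noteq> {}" by (auto simp: S_def)
  \<comment> \<open>The nodes of maximal modulus are closed under passing to the support of their
    rows.\<close>
  have "S = {..<n}"
  proof (rule irreducible_mat_closed_set[OF A assms(3)])
    fix i k assume "i \<in> S" "k < n" "A $$ (i, k) \<noteq> 0"
    with row_stochastic_max_modulus_step[OF A assms(2) z eig, of i k] le
    show "k \<in> S" by (auto simp: S_def)
  qed (use \<open>S \<noteq> {}\<close> in \<open>auto simp: S_def\<close>)
  with assms(4) have "j \<in> S" by simp
  with vj have "M = 0" by (simp add: S_def)
  with le have "v = 0\<^sub>v n" using v by (intro eq_vecI) auto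
  with v show False by simp
qed

end
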